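(* Let $f$ be a symbol of degree $k$ on $(0,\infty)$, i.e. a smooth function such that for every $r\in\mathbb N$ there is a constant $C_r$ with $|f^{(r)}(x)|\le C_r x^{k-r}$. For $r\ge0$ define $$f_r(s)=\frac{\int_0^\infty (x-s)^r x^s e^{-x}\,dx}{\int_0^\infty x^s e^{-x}\,dx}=\sum_{i=0}^r(-1)^{r-i}\binom{r}{i}s^{[i]}s^{r-i},\qquad s^{[i]}=(s+1)(s+2)\cdots(s+i).$$ Then each $f_r$ is a polynomial in $s$ with integer coefficients of degree $[r/2]$, and the twisted Mellin transform $$\mathcal{M}f(s)=\frac{\int_0^\infty f(x)\,x^s e^{-x}\,dx}{\int_0^\infty x^s e^{-x}\,dx}$$ has the asymptotic expansion, as $s\to+\infty$, $$\mathcal{M}f(s)\sim\sum_{r=0}^\infty\frac{1}{r!}f^{(r)}(s)\,f_r(s).$$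
   Context: Here $[r/2]$ is the integer part of $r/2$ and $s^{[0]}=1$. The symbol "$\sim$" means an asymptotic expansion as $s\to+\infty$: the $r$-th term is $O(s^{k-r+[r/2]})$, and for each $R$ the difference between $\mathcal Mf(s)$ and the sum of the terms with $r<R$ is of lower order than the retained terms (it is $O(s^{k-R/2})$). *)

theory Defs
  imports "HOL-Analysis.Analysis" "HOL-Library.Landau_Symbols"
    "HOL-Computational_Algebra.Polynomial"
begin

(* The classes {real_normed_field, euclidean_space} admit both real- and complex-valued
   functions of a real variable. *)

definition nth_deriv :: "nat \<Rightarrow> (real \<Rightarrow> 'a::real_normed_vector) \<Rightarrow> real \<Rightarrow> 'a" where
  "nth_deriv r f = ((\<lambda>g x. vector_derivative g (at x)) ^^ r) f"

(* A function on (0,\<infinity>) is a total function on the reals of which only the values at x > 0 matter. *)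
definition smooth_pos :: "(real \<Rightarrow> 'a::real_normed_vector) \<Rightarrow> bool" where
  "smooth_pos f \<longleftrightarrow> (\<forall>r. \<forall>x>0. nth_deriv r f differentiable (at x))"

definition symbol_of_degree :: "real \<Rightarrow> (real \<Rightarrow> 'a::real_normed_vector) \<Rightarrow> bool" where
  "symbol_of_degree k f \<longleftrightarrow>
     smooth_pos f \<and> (\<forall>r. \<exists>C. \<forall>x>0. norm (nth_deriv r f x) \<le> C * x powr (k - real r))"

definition twisted_mellin ::
    "(real \<Rightarrow> 'a::{real_normed_field, euclidean_space}) \<Rightarrow> real \<Rightarrow> 'a" where
  "twisted_mellin f s =
     (LINT x:{0<..}|lborel. f x * of_real (x powr s * exp (- x))) /
     of_real (LINT x:{0<..}|lborel. x powr s * exp (- x))"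

definition tm_coeff :: "nat \<Rightarrow> real \<Rightarrow> real" where
  "tm_coeff r s =
     (LINT x:{0<..}|lborel. (x - s) ^ r * (x powr s * exp (- x))) /
     (LINT x:{0<..}|lborel. x powr s * exp (- x))"

definition tm_term ::
    "(real \<Rightarrow> 'a::{real_normed_field, euclidean_space}) \<Rightarrow> nat \<Rightarrow> real \<Rightarrow> 'a" where
  "tm_term f r s = 1 / fact r * nth_deriv r f s * of_real (tm_coeff r s)"

end

theory Submission
  imports Defs "HOL-Real_Asymp.Real_Asymp"
begin

text \<open>
  Expand \<open>f\<close> around \<open>s\<close> by Taylor's formula of order \<open>R\<close>; averaging the Taylor polynomial against
  the normalised weight \<open>x\<^sup>s e\<^sup>-\<^sup>x\<close> gives exactly the first \<open>R\<close> terms of the expansion. The Lagrange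
  remainder is at most a constant times \<open>\<bar>x - s\<bar>\<^sup>R (s\<^sup>a + x\<^sup>a)\<close> with \<open>a = k - R\<close> for all \<open>x > 0\<close>, so no
  splitting into near and far regions is needed: the factor \<open>x\<^sup>a\<close> is dominated by \<open>x\<^sup>m\<close> and \<open>x\<^sup>-\<^sup>m\<close>
  with \<open>m\<close> an integer, and these merely shift \<open>s\<close> to \<open>s \<plusminus> m\<close> in the weight. What is left is that the
  \<open>R\<close>-th absolute moment of the Gamma distribution about \<open>s\<close> is \<open>O(s\<^sup>R\<^sup>/\<^sup>2)\<close>. This and the
  polynomiality of \<open>f\<^sub>r\<close> both come from \<open>f\<^sub>r\<^sub>+\<^sub>1 = (r + 1) f\<^sub>r + r s f\<^sub>r\<^sub>-\<^sub>1\<close>.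
\<close>

section \<open>Integrals against the Gamma weight\<close>

text \<open>Euler's integral enters as a Henstock-Kurzweil integral over \<open>{0..}\<close>.
  Dropping the endpoint changes it only on a null set, and nonnegativity turns it into an absolutely
  convergent, hence Lebesgue, integral. Borel measurability of the integrand then allows the passage
  from \<open>lebesgue\<close> to \<open>lborel\<close>.\<close>

lemma has_bochner_integral_gamma_weight:
  fixes s :: real
  assumes "s > -1"
  shows "has_bochner_integral lborel (\<lambda>x. indicator {0<..} x *\<^sub>R (x powr s * exp (- x))) (Gamma (s + 1))"
proof -
  let ?w = "\<lambda>x::real. x powr s * exp (- x)"
  have "(?w has_integral Gamma (s + 1)) {0..}"
    using Gamma_integral_real[of "s + 1"] assms by (simp add: exp_minus divide_inverse)
  then have int: "(?w has_integral Gamma (s + 1)) {0<..}"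
    by (subst has_integral_spike_set_eq[where T = "{0..}"])
       (auto intro: negligible_subset[of "{0}"])
  have "?w absolutely_integrable_on {0<..}"
    by (rule nonnegative_absolutely_integrable_1) (use int in \<open>auto intro: has_integral_integrable\<close>)
  then have "set_integrable lebesgue {0<..} ?w" .
  then have si: "set_integrable lborel {0<..} ?w"
    unfolding set_integrable_def by (subst (asm) integrable_completion) simp_all
  show ?thesis
    unfolding has_bochner_integral_iff
    using si set_borel_integral_eq_integral(2)[OF si] integral_unique[OF int]
    by (simp add: set_integrable_def set_lebesgue_integral_def)
qed

text \<open>The factor \<open>x ^ i\<close> only moves the exponent from \<open>s\<close> to
  \<open>s + i\<close>, and the quotient of the two Gamma values is the rising factorial.\<close>

lemma has_bochner_integral_gamma_weight_monom:
  fixes s :: real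
  assumes "s > -1"
  shows "has_bochner_integral lborel (\<lambda>x. indicator {0<..} x *\<^sub>R (x ^ i * (x powr s * exp (- x))))
           (pochhammer (s + 1) i * Gamma (s + 1))"
proof -
  have "s + 1 \<notin> \<int>\<^sub>\<le>\<^sub>0"
    using assms by (auto elim!: nonpos_Ints_cases)
  moreover have "Gamma (s + 1) \<noteq> 0"
    using Gamma_real_pos[of "s + 1"] assms by linarith
  ultimately have "pochhammer (s + 1) i * Gamma (s + 1) = Gamma (s + real i + 1)"
    by (simp add: pochhammer_Gamma add_ac)
  moreover have "indicator {0<..} x *\<^sub>R (x ^ i * (x powr s * exp (- x))) =
      indicator {0<..} x *\<^sub>R (x powr (s + real i) * exp (- x))" for x :: real
    by (auto simp: indicator_def powr_add powr_realpow)
  moreover have "s + real i > -1"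
    using assms by linarith
  ultimately show ?thesis
    using has_bochner_integral_gamma_weight[of "s + real i"] by (simp only:)
qed

text \<open>The \<open>r\<close>-th moment about \<open>c\<close> of the Gamma distribution with shape \<open>s + 1\<close>.\<close>

definition shifted_moment :: "real \<Rightarrow> real \<Rightarrow> nat \<Rightarrow> real" where
  "shifted_moment s c r = (\<Sum>i\<le>r. real (r choose i) * (- c) ^ (r - i) * pochhammer (s + 1) i)"

text \<open>Binomial expansion of \<open>(x - c) ^ r\<close> reduces this to monomials. The centre
  \<open>c\<close> is independent of the exponent \<open>s\<close> because the remainder estimate
  shifts the exponent while the centre stays put.\<close>

lemma has_bochner_integral_shifted_moment:
  fixes s c :: real
  assumes "s > -1"
  shows "has_bochner_integral lborel (\<lambda>x. indicator {0<..} x *\<^sub>R ((x - c) ^ r * (x powr s * exp (- x))))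
           (shifted_moment s c r * Gamma (s + 1))"
proof -
  have "has_bochner_integral lborel
      (\<lambda>x. \<Sum>i\<le>r. (real (r choose i) * (- c) ^ (r - i)) *
         (indicator {0<..} x *\<^sub>R (x ^ i * (x powr s * exp (- x)))))
      (\<Sum>i\<le>r. (real (r choose i) * (- c) ^ (r - i)) * (pochhammer (s + 1) i * Gamma (s + 1)))"
    by (intro has_bochner_integral_sum has_bochner_integral_mult_right
        has_bochner_integral_gamma_weight_monom assms)
  moreover have "(\<Sum>i\<le>r. (real (r choose i) * (- c) ^ (r - i)) *
         (indicator {0<..} x *\<^sub>R (x ^ i * (x powr s * exp (- x))))) =
      indicator {0<..} x *\<^sub>R ((x - c) ^ r * (x powr s * exp (- x)))" for x
    using binomial_ring[of x "- c" r]
    by (simp add: sum_distrib_left[symmetric] sum_distrib_right sum_distrib_left mult_ac)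
  ultimately show ?thesis
    by (simp add: shifted_moment_def sum_distrib_left sum_distrib_right mult_ac)
qed

lemma tm_coeff_eq_shifted_moment:
  assumes "s > -1"
  shows "tm_coeff r s = shifted_moment s s r"
proof -
  have "Gamma (s + 1) \<noteq> 0"
    using Gamma_real_pos[of "s + 1"] assms by linarith
  then show ?thesis
    using has_bochner_integral_integral_eq[OF has_bochner_integral_shifted_moment[OF assms, of s r]]
      has_bochner_integral_integral_eq[OF has_bochner_integral_gamma_weight[OF assms]]
    by (simp add: tm_coeff_def set_lebesgue_integral_def)
qed

lemma tm_coeff_eq_sum:
  assumes "s > -1"
  shows "tm_coeff r s =
    (\<Sum>i=0..r. (-1) ^ (r - i) * real (r choose i) * pochhammer (s + 1) i * s ^ (r - i))"
  unfolding tm_coeff_eq_shifted_moment[OF assms] shifted_moment_def atLeast0AtMost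
  by (intro sum.cong refl) (subst power_minus, simp add: mult_ac)

section \<open>The three-term recurrence and the coefficient polynomials\<close>

text \<open>When \<open>c - s\<close> is fixed, the factor \<open>s + 1 - c + r\<close> is constant
  in \<open>s\<close>. A factor of order \<open>s\<close> is thus gained only every second step,
  which is the source of the exponent \<open>r div 2\<close>. For \<open>r = 0\<close> the truncated
  index \<open>r - 1\<close> is harmless, since its term carries the factor
  \<open>r\<close>.\<close>

lemma shifted_moment_rec:
  "shifted_moment s c (Suc r) =
     (s + 1 - c + real r) * shifted_moment s c r + real r * c * shifted_moment s c (r - 1)"
proof -
  let ?P = "\<lambda>i. pochhammer (s + 1) i"
  define t where "t = (\<lambda>i. real (r choose i) * (- c) ^ (r - i))"
  have T: "shifted_moment s c r = (\<Sum>i\<le>r. t i * ?P i)"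
    by (simp add: shifted_moment_def t_def)
  have "shifted_moment s c (Suc r) = (\<Sum>i\<le>Suc r. real (Suc r choose i) * (- c) ^ (Suc r - i) * ?P i)"
    by (simp add: shifted_moment_def)
  \<comment> \<open>Pascal's rule splits the sum. The part without index shift reassembles to
    \<open>- c\<close> times the moment of order \<open>r\<close>.\<close>
  also have "\<dots> = (\<Sum>i\<le>r. t i * ?P (Suc i)) +
      ((- c) ^ Suc r + (\<Sum>i\<le>r. real (r choose Suc i) * (- c) ^ (r - i) * ?P (Suc i)))"
    by (subst sum.atMost_Suc_shift) (simp add: t_def sum.distrib[symmetric] algebra_simps)
  also have "(- c) ^ Suc r + (\<Sum>i\<le>r. real (r choose Suc i) * (- c) ^ (r - i) * ?P (Suc i)) =
      (\<Sum>i\<le>Suc r. real (r choose i) * (- c) ^ (Suc r - i) * ?P i)"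
    by (subst sum.atMost_Suc_shift) simp
  also have "\<dots> = - c * shifted_moment s c r"
    by (simp add: T t_def sum_distrib_left Suc_diff_le mult_ac)
  finally have 1: "shifted_moment s c (Suc r) = - c * shifted_moment s c r + (\<Sum>i\<le>r. t i * ?P (Suc i))"
    by simp
  \<comment> \<open>The new factor \<open>s + 1 + i\<close> of the rising factorial is written as
    \<open>(s + 1 + r) - (r - i)\<close>, so that only the second part still depends on
    \<open>i\<close>.\<close>
  have "(\<Sum>i\<le>r. t i * ?P (Suc i)) =
      (s + 1 + real r) * (\<Sum>i\<le>r. t i * ?P i) - (\<Sum>i\<le>r. real (r - i) * t i * ?P i)"
    unfolding sum_distrib_left sum_subtractf[symmetric]
    by (intro sum.cong) (auto simp: pochhammer_Suc of_nat_diff algebra_simps)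
  \<comment> \<open>Absorbing \<open>r - i\<close> into the binomial coefficient lowers
    \<open>r\<close> by one and so produces the moment of order \<open>r - 1\<close>.\<close>
  also have "(\<Sum>i\<le>r. real (r - i) * t i * ?P i) = - (real r * c * shifted_moment s c (r - 1))"
  proof (cases r)
    case 0
    then show ?thesis by simp
  next
    case (Suc q)
    have "real (r - i) * t i * ?P i = - (real r * c) * (real (q choose i) * (- c) ^ (q - i) * ?P i)"
      if "i \<le> q" for i
    proof -
      have "(r - i) * (r choose i) = r * (q choose i)"
        using binomial_absorb_comp[of r i] Suc by simp
      then have *: "real (r - i) * real (r choose i) = real r * real (q choose i)"
        by (metis of_nat_mult)
      have "(- c) ^ (r - i) = - c * (- c) ^ (q - i)"
        using that Suc by (simp add: Suc_diff_le)
      then show ?thesis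
        unfolding t_def using * by (simp add: mult.assoc[symmetric])
    qed
    then show ?thesis
      using Suc by (simp add: shifted_moment_def sum_distrib_left sum_negf[symmetric])
  qed
  finally show ?thesis
    using 1 T by (simp add: algebra_simps)
qed

text \<open>This is the recurrence at \<open>c = s\<close>, with \<open>pCons 0\<close> as
  multiplication by \<open>s\<close>; integrality of the coefficients is then built in.\<close>

fun tm_coeff_poly :: "nat \<Rightarrow> int poly" where
  "tm_coeff_poly 0 = 1"
| "tm_coeff_poly (Suc 0) = 1"
| "tm_coeff_poly (Suc (Suc r)) =
     smult (int (r + 2)) (tm_coeff_poly (Suc r)) + smult (int (r + 1)) (pCons 0 (tm_coeff_poly r))"

lemma poly_tm_coeff_poly:
  "poly (map_poly real_of_int (tm_coeff_poly r)) s = shifted_moment s s r"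
proof (induction r rule: tm_coeff_poly.induct)
  case 1
  show ?case by (simp add: shifted_moment_def)
next
  case 2
  show ?case using shifted_moment_rec[of s s 0] by (simp add: shifted_moment_def)
next
  case (3 r)
  have "map_poly real_of_int (tm_coeff_poly (Suc (Suc r))) =
      smult (real (r + 2)) (map_poly real_of_int (tm_coeff_poly (Suc r))) +
      smult (real (r + 1)) (pCons 0 (map_poly real_of_int (tm_coeff_poly r)))"
    by (intro poly_eqI) (simp add: coeff_map_poly coeff_pCons split: nat.split)
  then show ?case
    using 3 shifted_moment_rec[of s s "Suc r"] by (simp add: algebra_simps)
qed

text \<open>Positivity of the top coefficient is carried through the induction: for odd
  \<open>r\<close> both summands of the recurrence reach the top degree, and only their signs
  exclude cancellation.\<close>

lemma tm_coeff_poly_degree_aux: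
  "degree (tm_coeff_poly r) = r div 2 \<and> coeff (tm_coeff_poly r) (r div 2) > 0"
proof (induction r rule: tm_coeff_poly.induct)
  case (3 r)
  let ?p = "tm_coeff_poly (Suc (Suc r))"
  have "coeff (tm_coeff_poly (Suc r)) (Suc r div 2) > 0" "degree (tm_coeff_poly (Suc r)) = Suc r div 2"
    "coeff (tm_coeff_poly r) (r div 2) > 0" "degree (tm_coeff_poly r) = r div 2"
    using 3 by auto
  \<comment> \<open>By parity of \<open>r\<close>, the coefficient of
    \<open>tm_coeff_poly (Suc r)\<close> at \<open>Suc (r div 2)\<close> either lies above the
    degree and is zero, or is the positive top coefficient.\<close>
  moreover have "Suc r div 2 = r div 2 \<or> Suc r div 2 = Suc (r div 2)"
    by presburger
  ultimately have "coeff (tm_coeff_poly (Suc r)) (Suc (r div 2)) \<ge> 0"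
    by (metis coeff_eq_0 less_Suc_eq_le order.refl less_imp_le)
  moreover have "degree ?p \<le> Suc (r div 2)"
    using 3 by (auto intro!: degree_add_le order.trans[OF degree_smult_le] order.trans[OF degree_pCons_le])
  moreover have "coeff (tm_coeff_poly r) (r div 2) > 0"
    using 3 by auto
  ultimately have "coeff ?p (Suc (r div 2)) > 0"
    by (simp add: add_nonneg_pos)
  with \<open>degree ?p \<le> _\<close> show ?case
    by (metis div2_Suc_Suc le_antisym le_degree less_irrefl)
qed auto

lemma degree_tm_coeff_poly: "degree (tm_coeff_poly r) = r div 2"
  using tm_coeff_poly_degree_aux by blast

section \<open>Growth of the moments as \<open>s\<close> tends to infinity\<close>

lemma powr_bigo_powr:
  fixes a b :: real
  assumes "a \<le> b"
  shows "(\<lambda>s. s powr a) \<in> O[at_top](\<lambda>s::real. s powr b)"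
  using assms
  by (intro bigoI[of _ 1] eventually_mono[OF eventually_ge_at_top[of 1]]) (auto intro: powr_mono)

text \<open>In the recurrence, the moment one order below is multiplied by the constant
  \<open>c + 1 + q\<close>, and the one two orders below by \<open>q * s\<close>. Both products stay
  within the power \<open>r div 2\<close>.\<close>

lemma shifted_moment_bigo:
  "(\<lambda>s. shifted_moment (s + c) s r) \<in> O[at_top](\<lambda>s. s powr real (r div 2))"
proof (induction r rule: less_induct)
  case (less r)
  show ?case
  proof (cases r)
    case 0
    have "(\<lambda>s. 1 :: real) \<in> O[at_top](\<lambda>s::real. s powr 0)"
      by (intro bigoI[of _ 1] eventually_mono[OF eventually_gt_at_top[of 0]]) auto
    then show ?thesis using 0 by (simp add: shifted_moment_def)
  next
    case (Suc q)
    have "(\<lambda>s. shifted_moment (s + c) s q) \<in> O[at_top](\<lambda>s. s powr real (r div 2))"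
      using landau_o.big_trans[OF less.IH[of q] powr_bigo_powr[of "real (q div 2)" "real (r div 2)"]] Suc
      by (simp add: div_le_mono)
    moreover have "(\<lambda>_. c + 1 + real q) \<in> O[at_top](\<lambda>_ :: real. 1 :: real)"
      by (rule bigoI[of _ "\<bar>c + 1 + real q\<bar>"]) simp
    ultimately have 1: "(\<lambda>s. (c + 1 + real q) * shifted_moment (s + c) s q) \<in> O[at_top](\<lambda>s. s powr real (r div 2))"
      using landau_o.big.mult by fastforce
    have 2: "(\<lambda>s. real q * s * shifted_moment (s + c) s (q - 1)) \<in> O[at_top](\<lambda>s. s powr real (r div 2))"
    proof (cases q)
      case 0
      then show ?thesis by simp
    next
      case (Suc p)
      have "(\<lambda>s. (real q * s) * shifted_moment (s + c) s p) \<in> O[at_top](\<lambda>s. s * s powr real (p div 2))"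
        using less.IH[of p] \<open>r = Suc q\<close> Suc by (intro landau_o.big.mult) auto
      moreover have "\<forall>\<^sub>F s::real in at_top. s * s powr real (p div 2) = s powr real (r div 2)"
        using eventually_gt_at_top[of 0]
        by eventually_elim (simp add: \<open>r = Suc q\<close> Suc powr_add)
      ultimately show ?thesis
        using Suc by (simp cong: landau_o.big.cong)
    qed
    show ?thesis
      using sum_in_bigo(1)[OF 1 2] Suc by (simp add: shifted_moment_rec add_ac)
  qed
qed

text \<open>For integer shifts the functional equation of Gamma suffices: induction in both
  directions multiplies by \<open>s + i + 1\<close> or divides by \<open>s + i\<close>, each step
  changing the exponent by one.\<close>

lemma Gamma_ratio_bigo:
  fixes c :: int
  shows "(\<lambda>s. Gamma (s + of_int c + 1) / Gamma (s + 1)) \<in> O[at_top](\<lambda>s::real. s powr of_int c)"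
proof (induction c rule: int_induct[where k = 0])
  case base
  show ?case
    by (intro bigoI[of _ 1] eventually_mono[OF eventually_gt_at_top[of 0]]) auto
next
  case (step1 i)
  have e1: "\<forall>\<^sub>F s in at_top. (s + of_int i + 1) * (Gamma (s + of_int i + 1) / Gamma (s + 1)) =
      Gamma (s + of_int (i + 1) + 1) / Gamma (s + 1 :: real)"
    using eventually_gt_at_top[of "- of_int i"]
  proof eventually_elim
    case (elim s)
    then have "s + of_int i + 1 \<notin> \<int>\<^sub>\<le>\<^sub>0"
      by (auto elim!: nonpos_Ints_cases)
    then show ?case
      using Gamma_plus1[of "s + of_int i + 1"] by (simp add: add_ac)
  qed
  have b: "(\<lambda>s. (s + of_int i + 1) * (Gamma (s + of_int i + 1) / Gamma (s + 1)))
      \<in> O[at_top](\<lambda>s::real. s * s powr of_int i)"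
    by (rule landau_o.big.mult[OF _ step1.IH]) real_asymp
  have e2: "\<forall>\<^sub>F s::real in at_top. s * s powr of_int i = s powr of_int (i + 1)"
    using eventually_gt_at_top[of 0] by eventually_elim (simp add: powr_add)
  show ?case
    using b unfolding landau_o.big.in_cong[OF e1] landau_o.big.cong[OF e2] .
next
  case (step2 i)
  have e1: "\<forall>\<^sub>F s in at_top. 1 / (s + of_int i) * (Gamma (s + of_int i + 1) / Gamma (s + 1)) =
      Gamma (s + of_int (i - 1) + 1) / Gamma (s + 1 :: real)"
    using eventually_gt_at_top[of "- of_int i"]
  proof eventually_elim
    case (elim s)
    then have "s + of_int i \<notin> \<int>\<^sub>\<le>\<^sub>0" "s + of_int i \<noteq> 0"
      by (auto elim!: nonpos_Ints_cases)
    then have "Gamma (s + of_int i + 1) = (s + of_int i) * Gamma (s + of_int i)"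
      by (intro Gamma_plus1)
    then show ?case
      using \<open>s + of_int i \<noteq> 0\<close> by simp
  qed
  have b: "(\<lambda>s. 1 / (s + of_int i) * (Gamma (s + of_int i + 1) / Gamma (s + 1)))
      \<in> O[at_top](\<lambda>s::real. 1 / s * s powr of_int i)"
    by (rule landau_o.big.mult[OF _ step2.IH]) real_asymp
  have e2: "\<forall>\<^sub>F s::real in at_top. 1 / s * s powr of_int i = s powr of_int (i - 1)"
    using eventually_gt_at_top[of 0] by eventually_elim (simp add: powr_diff)
  show ?case
    using b unfolding landau_o.big.in_cong[OF e1] landau_o.big.cong[OF e2] .
qed

lemma integrable_abs_moment:
  fixes u c :: real
  assumes "u > -1"
  shows "integrable lborel (\<lambda>x. indicator {0<..} x *\<^sub>R (\<bar>x - c\<bar> ^ n * (x powr u * exp (- x))))"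
proof -
  have "integrable lborel (\<lambda>x. norm (indicator {0<..} x *\<^sub>R ((x - c) ^ n * (x powr u * exp (- x)))))"
    using has_bochner_integral_shifted_moment[OF assms, of c n]
    by (intro integrable_norm) (simp add: has_bochner_integral_iff)
  then show ?thesis
    by (simp add: abs_mult power_abs)
qed

text \<open>Even moments need no absolute value, so the one of order \<open>2 * n\<close> is a
  shifted moment of size \<open>O(s powr n)\<close>, up to the Gamma ratio. It controls the absolute
  moment of order \<open>n\<close>; the exponent shift \<open>c\<close> enters through the Gamma
  ratio as \<open>s powr c\<close>.\<close>

lemma abs_moment_bigo:
  fixes c :: int
  shows "(\<lambda>s. (LINT x:{0<..}|lborel. \<bar>x - s\<bar> ^ n * (x powr (s + of_int c) * exp (- x))) / Gamma (s + 1))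
           \<in> O[at_top](\<lambda>s. s powr (real n / 2 + of_int c))"
proof -
  \<comment> \<open>This choice balances the two parts of the bound \<open>A + T / A\<close>, since
    \<open>T\<close> is \<open>O(A\<^sup>2)\<close>.\<close>
  define A where "A = (\<lambda>s::real. s powr (real n / 2))"
  define T where "T = (\<lambda>s. shifted_moment (s + of_int c) s (2 * n))"
  define I where "I = (\<lambda>s::real. LINT x:{0<..}|lborel. \<bar>x - s\<bar> ^ n * (x powr (s + of_int c) * exp (- x)))"
  have "\<forall>\<^sub>F s in at_top. norm (I s / Gamma (s + 1)) \<le>
      norm (Gamma (s + of_int c + 1) / Gamma (s + 1) * (A s + 1 / A s * T s))"
    using eventually_gt_at_top[of 0] eventually_gt_at_top[of "-1 - of_int c"]
  proof eventually_elim
    case (elim s)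
    define w where "w = (\<lambda>x::real. x powr (s + of_int c) * exp (- x))"
    have fold_w: "x powr (s + of_int c) * exp (- x) = w x" for x
      by (simp add: w_def)
    have u: "s + of_int c > -1" and A: "A s > 0"
      using elim by (auto simp: A_def)
    have int: "integrable lborel (\<lambda>x. indicator {0<..} x *\<^sub>R (\<bar>x - s\<bar> ^ n * w x))"
      using integrable_abs_moment[OF u, of s n] unfolding fold_w .
    have G: "Gamma (s + 1) > 0" "Gamma (s + of_int c + 1) > 0"
      using elim by (auto intro!: Gamma_real_pos)
    have B: "has_bochner_integral lborel
        (\<lambda>x. A s * (indicator {0<..} x *\<^sub>R w x) + 1 / A s * (indicator {0<..} x *\<^sub>R ((x - s) ^ (2 * n) * w x)))
        (A s * Gamma (s + of_int c + 1) + 1 / A s * (T s * Gamma (s + of_int c + 1)))"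
      unfolding w_def T_def
      by (intro has_bochner_integral_add has_bochner_integral_mult_right
          has_bochner_integral_shifted_moment has_bochner_integral_gamma_weight u)
    have le: "indicator {0<..} x *\<^sub>R (\<bar>x - s\<bar> ^ n * w x) \<le>
        A s * (indicator {0<..} x *\<^sub>R w x) + 1 / A s * (indicator {0<..} x *\<^sub>R ((x - s) ^ (2 * n) * w x))"
      for x
    proof -
      \<comment> \<open>\<open>y \<le> A + y\<^sup>2 / A\<close> replaces the Cauchy-Schwarz inequality for the integrals\<close>
      define y where "y = \<bar>x - s\<bar> ^ n"
      have y: "(x - s) ^ (2 * n) = y\<^sup>2" "y \<ge> 0"
        by (auto simp: y_def power_mult[symmetric] power_even_abs mult.commute[of 2])
      have "y * A s \<le> A s * A s + y\<^sup>2"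
      proof (cases "y \<le> A s")
        case True
        then show ?thesis using A by (simp add: mult_right_mono add_increasing2)
      next
        case False
        then have "y * A s \<le> y\<^sup>2" using y by (simp add: power2_eq_square mult_left_mono)
        then show ?thesis using A by (simp add: add_increasing)
      qed
      then have "y \<le> A s + 1 / A s * y\<^sup>2"
        using A by (simp add: field_simps)
      then have "y * w x \<le> (A s + 1 / A s * y\<^sup>2) * w x"
        by (intro mult_right_mono) (auto simp: w_def)
      then show ?thesis
        unfolding y(1) y_def[symmetric] by (simp add: indicator_def algebra_simps)
    qed
    have "I s \<le> A s * Gamma (s + of_int c + 1) + 1 / A s * (T s * Gamma (s + of_int c + 1))"
      unfolding I_def set_lebesgue_integral_def fold_w has_bochner_integral_integral_eq[OF B, symmetric]
      by (intro integral_mono int integrable.intros[OF B] le)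
    also have "\<dots> = Gamma (s + of_int c + 1) * (A s + 1 / A s * T s)"
      by (simp add: algebra_simps)
    finally have "I s / Gamma (s + 1) \<le> Gamma (s + of_int c + 1) / Gamma (s + 1) * (A s + 1 / A s * T s)"
      using G by (simp add: divide_right_mono)
    moreover have "I s \<ge> 0"
      unfolding I_def set_lebesgue_integral_def by (intro integral_nonneg_AE) auto
    then have "I s / Gamma (s + 1) \<ge> 0"
      using G by simp
    ultimately show ?case
      unfolding real_norm_def by linarith
  qed
  moreover have "(\<lambda>s. Gamma (s + of_int c + 1) / Gamma (s + 1) * (A s + 1 / A s * T s)) \<in>
      O[at_top](\<lambda>s. s powr of_int c * A s)"
  proof (intro landau_o.big.mult Gamma_ratio_bigo sum_in_bigo)
    have "(\<lambda>s. 1 / A s * T s) \<in> O[at_top](\<lambda>s. 1 / A s * s powr real n)"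
      using shifted_moment_bigo[of "of_int c" "2 * n"] unfolding T_def
      by (intro landau_o.big.mult landau_o.big_refl) simp
    moreover have "\<forall>\<^sub>F s in at_top. 1 / A s * s powr real n = A s"
      using eventually_gt_at_top[of 0]
      by eventually_elim (simp add: A_def field_simps flip: powr_add)
    ultimately show "(\<lambda>s. 1 / A s * T s) \<in> O[at_top](A)"
      by (simp cong: landau_o.big.cong)
  qed simp_all
  ultimately have "(\<lambda>s. I s / Gamma (s + 1)) \<in> O[at_top](\<lambda>s. s powr of_int c * A s)"
    by (rule landau_o.big_trans[OF landau_o.big_mono])
  then show ?thesis
    unfolding I_def A_def by (simp add: powr_add mult.commute)
qed

section \<open>Taylor remainders and bounds for powers\<close>

text \<open>The Lagrange form fails for vector-valued functions; here it is applied to the inner product of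
  \<open>f\<close> with the remainder vector itself.\<close>

lemma Taylor_remainder_norm_le:
  fixes f :: "real \<Rightarrow> 'a::real_inner"
  assumes D0: "D 0 = f"
    and deriv: "\<And>r t. r < n \<Longrightarrow> t \<in> closed_segment c x \<Longrightarrow> (D r has_vector_derivative D (Suc r) t) (at t)"
    and bound: "\<And>t. t \<in> closed_segment c x \<Longrightarrow> norm (D n t) \<le> B"
  shows "norm (f x - (\<Sum>r<n. ((x - c) ^ r / fact r) *\<^sub>R D r c)) \<le> B * \<bar>x - c\<bar> ^ n / fact n"
proof -
  define v where "v = f x - (\<Sum>r<n. ((x - c) ^ r / fact r) *\<^sub>R D r c)"
  have B: "B \<ge> 0"
    using bound[of c] norm_ge_zero order.trans by (metis ends_in_segment(1))
  \<comment> \<open>The Lagrange form is available for positive order and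
    \<open>x \<noteq> c\<close>; the two degenerate cases are checked directly.\<close>
  consider "n = 0" | "n > 0" "x = c" | "n > 0" "x \<noteq> c" by blast
  then have "norm v \<le> B * \<bar>x - c\<bar> ^ n / fact n"
  proof cases
    case 1
    then show ?thesis using bound[of x] D0 by (simp add: v_def)
  next
    case 2
    have "(\<Sum>r<n. ((x - c) ^ r / fact r) *\<^sub>R D r c) = (\<Sum>r\<in>{0}. ((x - c) ^ r / fact r) *\<^sub>R D r c)"
      using 2 by (intro sum.mono_neutral_right) auto
    then show ?thesis using 2 D0 B by (simp add: v_def)
  next
    case 3
    have "\<exists>t. (if x < c then x < t \<and> t < c else c < t \<and> t < x) \<and>
        v \<bullet> f x = (\<Sum>m<n. (v \<bullet> D m c) / fact m * (x - c) ^ m) + (v \<bullet> D n t) / fact n * (x - c) ^ n"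
    proof (rule Taylor[where a = "min c x" and b = "max c x" and diff = "\<lambda>m t. v \<bullet> D m t"])
      show "\<forall>m t. m < n \<and> min c x \<le> t \<and> t \<le> max c x \<longrightarrow>
          DERIV (\<lambda>t. v \<bullet> D m t) t :> v \<bullet> D (Suc m) t"
      proof (intro allI impI)
        fix m t assume *: "m < n \<and> min c x \<le> t \<and> t \<le> max c x"
        then have "(D m has_vector_derivative D (Suc m) t) (at t)"
          by (intro deriv) (auto simp: closed_segment_eq_real_ivl)
        then have "((\<lambda>t. v \<bullet> D m t) has_vector_derivative v \<bullet> D (Suc m) t) (at t)"
          by (rule bounded_linear.has_vector_derivative[OF bounded_linear_inner_right])
        then show "DERIV (\<lambda>t. v \<bullet> D m t) t :> v \<bullet> D (Suc m) t"
          by (simp add: has_real_derivative_iff_has_vector_derivative)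
      qed
    qed (use 3 D0 in auto)
    then obtain t where "if x < c then x < t \<and> t < c else c < t \<and> t < x"
      and eq: "v \<bullet> f x = (\<Sum>m<n. (v \<bullet> D m c) / fact m * (x - c) ^ m) + (v \<bullet> D n t) / fact n * (x - c) ^ n"
      by blast
    then have t: "t \<in> closed_segment c x"
      by (auto simp: closed_segment_eq_real_ivl split: if_splits)
    have "norm v * norm v = v \<bullet> v"
      by (simp add: norm_eq_sqrt_inner)
    \<comment> \<open>Only the second \<open>v\<close> is unfolded: its Taylor polynomial cancels
      the sum in \<open>eq\<close>. One factor \<open>norm v\<close> is cancelled at the
      end.\<close>
    also have "\<dots> = (v \<bullet> D n t) / fact n * (x - c) ^ n"
      using eq by (subst (2) v_def) (simp add: inner_diff_right inner_sum_right mult_ac)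
    also have "\<dots> \<le> \<bar>v \<bullet> D n t\<bar> * (\<bar>x - c\<bar> ^ n / fact n)"
      by (rule order.trans[OF abs_ge_self]) (simp add: abs_mult power_abs)
    also have "\<dots> \<le> (norm v * B) * (\<bar>x - c\<bar> ^ n / fact n)"
      using Cauchy_Schwarz_ineq2[of v "D n t"] mult_left_mono[OF bound[OF t], of "norm v"]
      by (intro mult_right_mono) auto
    finally have "norm v * norm v \<le> norm v * (B * \<bar>x - c\<bar> ^ n / fact n)"
      by (simp add: mult_ac)
    then have "norm v \<le> B * \<bar>x - c\<bar> ^ n / fact n" if "v \<noteq> 0"
      by (rule mult_left_le_imp_le) (use that in simp)
    then show ?thesis
      using B by (cases "v = 0") auto
  qed
  then show ?thesis unfolding v_def .
qed

lemma has_vector_derivative_nth_deriv: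
  assumes "smooth_pos f" "x > 0"
  shows "(nth_deriv r f has_vector_derivative nth_deriv (Suc r) f x) (at x)"
  using assms by (simp add: smooth_pos_def nth_deriv_def vector_derivative_works)

lemma nth_deriv_0 [simp]: "nth_deriv 0 f = f"
  by (simp add: nth_deriv_def)

text \<open>A real power is monotone, so on a segment it is largest at an endpoint; which one
  depends on the sign of \<open>a\<close>, and the sum covers both.\<close>

lemma powr_le_endpoint_sum:
  fixes a s t x :: real
  assumes "s > 0" "x > 0" "t \<in> closed_segment s x"
  shows "t powr a \<le> s powr a + x powr a"
proof -
  have t: "min s x \<le> t" "t \<le> max s x" "t > 0"
    using assms by (auto simp: closed_segment_eq_real_ivl split: if_splits)
  have "t powr a \<le> max (s powr a) (x powr a)"
  proof (cases "a \<ge> 0")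
    case True
    then have "t powr a \<le> (max s x) powr a"
      using t by (intro powr_mono2) auto
    then show ?thesis by (auto simp: max_def split: if_splits)
  next
    case False
    then have "t powr a \<le> (min s x) powr a"
      using t assms by (intro powr_mono2') auto
    then show ?thesis by (auto simp: min_def split: if_splits)
  qed
  then show ?thesis
    using powr_ge_zero[of s a] powr_ge_zero[of x a] by linarith
qed

text \<open>In terms of \<open>y = x / s\<close>, both \<open>1\<close> and \<open>y powr a\<close>
  lie below \<open>y powr m + y powr (- m)\<close>, whence the factor 2. With integer
  \<open>m\<close> the powers of \<open>x\<close> become integer shifts of the weight
  exponent.\<close>

lemma powr_sum_le_two_sided:
  fixes a m s x :: real
  assumes "s > 0" "x > 0" "\<bar>a\<bar> \<le> m"
  shows "s powr a + x powr a \<le> 2 * (s powr (a - m) * x powr m + s powr (a + m) * x powr (- m))"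
proof -
  define y where "y = x / s"
  have y: "y > 0" "x = s * y" using assms by (auto simp: y_def)
  have "y powr b \<le> y powr m + y powr (- m)" if "\<bar>b\<bar> \<le> m" for b
  proof (cases "y \<ge> 1")
    case True
    then have "y powr b \<le> y powr m" using that by (intro powr_mono) auto
    then show ?thesis using powr_ge_zero[of y "- m"] by linarith
  next
    case False
    then have "y powr b \<le> y powr (- m)" using that y by (intro powr_mono') auto
    then show ?thesis using powr_ge_zero[of y m] by linarith
  qed
  from this[of 0] this[of a] have "1 + y powr a \<le> 2 * (y powr m + y powr (- m))"
    using assms y abs_ge_zero[of a] by simp
  then have "s powr a * (1 + y powr a) \<le> s powr a * (2 * (y powr m + y powr (- m)))"
    by (intro mult_left_mono) auto
  moreover have "s powr a * s powr (- m) * s powr m = s powr a"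
    using assms by (simp flip: powr_add)
  ultimately show ?thesis
    using assms y by (simp add: powr_mult powr_diff powr_add powr_minus field_simps)
qed

lemma symbol_Taylor_remainder_le:
  fixes f :: "real \<Rightarrow> 'a::real_inner"
  assumes "smooth_pos f" "s > 0" "x > 0"
    and C: "\<And>t. t > 0 \<Longrightarrow> norm (nth_deriv n f t) \<le> C * t powr a"
  shows "norm (f x - (\<Sum>r<n. ((x - s) ^ r / fact r) *\<^sub>R nth_deriv r f s))
           \<le> C * (s powr a + x powr a) * \<bar>x - s\<bar> ^ n / fact n"
proof (rule Taylor_remainder_norm_le)
  have pos: "t > 0" if "t \<in> closed_segment s x" for t
    using that assms by (auto simp: closed_segment_eq_real_ivl split: if_splits)
  have "C \<ge> 0"
    using order.trans[OF norm_ge_zero C[of 1]] by simp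
  show "norm (nth_deriv n f t) \<le> C * (s powr a + x powr a)" if "t \<in> closed_segment s x" for t
    using C[OF pos[OF that]] powr_le_endpoint_sum[OF assms(2,3) that, of a] \<open>C \<ge> 0\<close>
    by (meson mult_left_mono order.trans)
  show "(nth_deriv r f has_vector_derivative nth_deriv (Suc r) f t) (at t)"
    if "r < n" "t \<in> closed_segment s x" for r t
    using has_vector_derivative_nth_deriv[OF assms(1) pos[OF that(2)]] .
qed simp

section \<open>Convergence and the asymptotic expansion\<close>

text \<open>The zeroth symbol estimate gives the integrable majorant
  \<open>C * x powr (s + k) * exp (- x)\<close>. Measurability follows from continuity of
  \<open>f\<close> on the positive half-line.\<close>

lemma symbol_set_integrable:
  fixes f :: "real \<Rightarrow> 'a::{real_normed_field, euclidean_space}"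
  assumes f: "symbol_of_degree k f" and "s + k > -1"
  shows "set_integrable lborel {0<..} (\<lambda>x. f x * of_real (x powr s * exp (- x)))"
proof -
  obtain C where C: "\<And>x. x > 0 \<Longrightarrow> norm (f x) \<le> C * x powr k"
    using f unfolding symbol_of_degree_def by (metis nth_deriv_0 diff_zero of_nat_0)
  have "C \<ge> 0"
    using order.trans[OF norm_ge_zero C[of 1]] by simp
  have "set_integrable lborel {0<..} (\<lambda>x. x powr (s + k) * exp (- x))"
    using has_bochner_integral_gamma_weight[OF assms(2)]
    by (simp add: set_integrable_def has_bochner_integral_iff)
  then have int: "set_integrable lborel {0<..} (\<lambda>x. C * (x powr (s + k) * exp (- x)))"
    by simp
  have "norm (f x * of_real (x powr s * exp (- x))) \<le> norm (C * (x powr (s + k) * exp (- x)))"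
    if "x > 0" for x
  proof -
    have "norm (f x) * (x powr s * exp (- x)) \<le> (C * x powr k) * (x powr s * exp (- x))"
      using C[OF that] by (intro mult_right_mono) auto
    then show ?thesis
      using \<open>C \<ge> 0\<close> by (simp add: norm_mult powr_add mult_ac)
  qed
  then have bound: "AE x in lborel. x \<in> {0<..} \<longrightarrow>
      norm (f x * of_real (x powr s * exp (- x))) \<le> norm (C * (x powr (s + k) * exp (- x)))"
    by simp
  have "continuous (at x) f" if "x > 0" for x
    using has_vector_derivative_nth_deriv[of f x 0] f that
    by (auto simp: symbol_of_degree_def intro: has_vector_derivative_continuous)
  then have "continuous_on {0<..} f"
    by (simp add: continuous_at_imp_continuous_on)
  then have "continuous_on {0<..} (\<lambda>x. f x * of_real (x powr s * exp (- x)))"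
    by (intro continuous_intros) auto
  then have meas: "set_borel_measurable lborel {0<..} (\<lambda>x. f x * of_real (x powr s * exp (- x)))"
    unfolding set_borel_measurable_def measurable_lborel2
    by (rule borel_measurable_continuous_on_indicator[rotated]) measurable
  show ?thesis
    by (rule set_integrable_bound[OF int meas bound])
qed

lemma tm_coeff_bigo: "tm_coeff r \<in> O[at_top](\<lambda>s. s powr real (r div 2))"
proof -
  have "\<forall>\<^sub>F s in at_top. shifted_moment s s r = tm_coeff r s"
    using eventually_gt_at_top[of "-1"] by eventually_elim (simp add: tm_coeff_eq_shifted_moment)
  then show ?thesis
    using shifted_moment_bigo[of 0 r] by (simp cong: landau_o.big.in_cong)
qed

lemma tm_term_bigo:
  fixes f :: "real \<Rightarrow> 'a::{real_normed_field, euclidean_space}"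
  assumes "symbol_of_degree k f"
  shows "(\<lambda>s. norm (tm_term f r s)) \<in> O[at_top](\<lambda>s. s powr (k - real r + real (r div 2)))"
proof -
  obtain C where C: "\<And>x. x > 0 \<Longrightarrow> norm (nth_deriv r f x) \<le> C * x powr (k - real r)"
    using assms unfolding symbol_of_degree_def by metis
  have "(\<lambda>s. norm (nth_deriv r f s) / fact r) \<in> O[at_top](\<lambda>s. s powr (k - real r))"
    using C by (intro bigoI[of _ "C / fact r"] eventually_mono[OF eventually_gt_at_top[of 0]])
      (auto simp: divide_right_mono)
  moreover have "(\<lambda>s. \<bar>tm_coeff r s\<bar>) \<in> O[at_top](\<lambda>s. s powr real (r div 2))"
    using tm_coeff_bigo[of r] by simp
  ultimately have "(\<lambda>s. norm (nth_deriv r f s) / fact r * \<bar>tm_coeff r s\<bar>) \<in>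
      O[at_top](\<lambda>s. s powr (k - real r) * s powr real (r div 2))"
    by (rule landau_o.big.mult)
  then show ?thesis
    by (simp add: tm_term_def norm_mult norm_divide powr_add)
qed

text \<open>\<open>Gamma (s + 1)\<close> times the error is the integral of the weighted Taylor
  remainder, which is dominated by two absolute moments with exponents \<open>s + m\<close> and
  \<open>s - m\<close>.\<close>

lemma twisted_mellin_remainder_bigo:
  fixes f :: "real \<Rightarrow> 'a::{real_normed_field, euclidean_space}"
  assumes f: "symbol_of_degree k f"
  shows "(\<lambda>s. norm (twisted_mellin f s - (\<Sum>r<n. tm_term f r s))) \<in> O[at_top](\<lambda>s. s powr (k - real n / 2))"
proof -
  define a where "a = k - real n"
  obtain C where C: "\<And>x. x > 0 \<Longrightarrow> norm (nth_deriv n f x) \<le> C * x powr a"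
    using f unfolding symbol_of_degree_def a_def by metis
  have "C \<ge> 0"
    using order.trans[OF norm_ge_zero C[of 1]] by simp
  define m where "m = nat \<lceil>\<bar>a\<bar>\<rceil>"
  have m: "\<bar>a\<bar> \<le> real m"
    unfolding m_def by linarith
  define J where "J = (\<lambda>(c::int) (s::real). LINT x:{0<..}|lborel. \<bar>x - s\<bar> ^ n * (x powr (s + of_int c) * exp (- x)))"
  \<comment> \<open>The 2 comes from the two-sided power bound, the rest from the Taylor
    remainder.\<close>
  define K where "K = 2 * C / fact n"
  define bnd where "bnd = (\<lambda>s. s powr (a - real m) * (J (int m) s / Gamma (s + 1)) +
      s powr (a + real m) * (J (- int m) s / Gamma (s + 1)))"
  have "\<forall>\<^sub>F s in at_top. norm (norm (twisted_mellin f s - (\<Sum>r<n. tm_term f r s))) \<le> K * norm (bnd s)"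
    \<comment> \<open>These thresholds make the centre \<open>s\<close> positive, the integral of
      \<open>f\<close> convergent, and the shifted exponent \<open>s - m\<close> admissible.\<close>
    using eventually_gt_at_top[of 0] eventually_gt_at_top[of "-1 - k"] eventually_gt_at_top[of "real m"]
  proof eventually_elim
    case (elim s)
    define w where "w = (\<lambda>x::real. x powr s * exp (- x))"
    define \<rho> where "\<rho> = (\<lambda>x. f x - (\<Sum>r<n. ((x - s) ^ r / fact r) *\<^sub>R nth_deriv r f s))"
    have G: "Gamma (s + 1) > 0"
      using elim by (intro Gamma_real_pos) auto
    have int_w: "(LINT x:{0<..}|lborel. w x) = Gamma (s + 1)"
      using has_bochner_integral_gamma_weight[of s] elim
      by (simp add: w_def set_lebesgue_integral_def has_bochner_integral_iff)
    have "has_bochner_integral lborel (\<lambda>x. indicator {0<..} x *\<^sub>R (f x * of_real (w x)))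
        (twisted_mellin f s * of_real (Gamma (s + 1)))"
      using symbol_set_integrable[OF f, of s] elim less_imp_neq[OF G] int_w
      by (simp add: has_bochner_integral_iff twisted_mellin_def set_integrable_def
          set_lebesgue_integral_def w_def)
    moreover have "has_bochner_integral lborel
        (\<lambda>x. \<Sum>r<n. (indicator {0<..} x *\<^sub>R ((x - s) ^ r * w x)) *\<^sub>R ((1 / fact r) *\<^sub>R nth_deriv r f s))
        (\<Sum>r<n. (shifted_moment s s r * Gamma (s + 1)) *\<^sub>R ((1 / fact r) *\<^sub>R nth_deriv r f s))"
      unfolding w_def using elim
      by (intro has_bochner_integral_sum has_bochner_integral_scaleR_left
          has_bochner_integral_shifted_moment) auto
    ultimately have "has_bochner_integral lborel
        (\<lambda>x. indicator {0<..} x *\<^sub>R (f x * of_real (w x)) -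
          (\<Sum>r<n. (indicator {0<..} x *\<^sub>R ((x - s) ^ r * w x)) *\<^sub>R ((1 / fact r) *\<^sub>R nth_deriv r f s)))
        (twisted_mellin f s * of_real (Gamma (s + 1)) -
          (\<Sum>r<n. (shifted_moment s s r * Gamma (s + 1)) *\<^sub>R ((1 / fact r) *\<^sub>R nth_deriv r f s)))"
      by (rule has_bochner_integral_diff)
    also have "(\<lambda>x. indicator {0<..} x *\<^sub>R (f x * of_real (w x)) -
          (\<Sum>r<n. (indicator {0<..} x *\<^sub>R ((x - s) ^ r * w x)) *\<^sub>R ((1 / fact r) *\<^sub>R nth_deriv r f s))) =
        (\<lambda>x. indicator {0<..} x *\<^sub>R (w x *\<^sub>R \<rho> x))"
    proof
      fix x
      show "indicator {0<..} x *\<^sub>R (f x * of_real (w x)) -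
          (\<Sum>r<n. (indicator {0<..} x *\<^sub>R ((x - s) ^ r * w x)) *\<^sub>R ((1 / fact r) *\<^sub>R nth_deriv r f s)) =
        indicator {0<..} x *\<^sub>R (w x *\<^sub>R \<rho> x)"
        by (cases "x > 0")
           (simp_all add: \<rho>_def right_diff_distrib sum_distrib_left scaleR_conv_of_real mult_ac)
    qed
    \<comment> \<open>Here the averaged Taylor polynomial is recognised as the partial sum of the
      expansion.\<close>
    also have "twisted_mellin f s * of_real (Gamma (s + 1)) -
          (\<Sum>r<n. (shifted_moment s s r * Gamma (s + 1)) *\<^sub>R ((1 / fact r) *\<^sub>R nth_deriv r f s)) =
        Gamma (s + 1) *\<^sub>R (twisted_mellin f s - (\<Sum>r<n. tm_term f r s))"
      using elim by (simp add: tm_term_def tm_coeff_eq_shifted_moment scaleR_conv_of_real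
          sum_distrib_left right_diff_distrib mult_ac)
    finally have E: "has_bochner_integral lborel (\<lambda>x. indicator {0<..} x *\<^sub>R (w x *\<^sub>R \<rho> x))
        (Gamma (s + 1) *\<^sub>R (twisted_mellin f s - (\<Sum>r<n. tm_term f r s)))" .
    let ?g = "\<lambda>c x. indicator {0<..} x *\<^sub>R (\<bar>x - s\<bar> ^ n * (x powr (s + of_int c) * exp (- x)))"
    have J: "has_bochner_integral lborel (?g c) (J c s)" if "c = int m \<or> c = - int m" for c
      using that elim integrable_abs_moment[of "s + of_int c" s n]
      by (auto simp: has_bochner_integral_iff J_def set_lebesgue_integral_def)
    have B: "has_bochner_integral lborel
        (\<lambda>x. K * (s powr (a - real m) * ?g (int m) x + s powr (a + real m) * ?g (- int m) x))
        (K * (s powr (a - real m) * J (int m) s + s powr (a + real m) * J (- int m) s))"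
      by (intro has_bochner_integral_mult_right has_bochner_integral_add J) auto
    have le: "norm (indicator {0<..} x *\<^sub>R (w x *\<^sub>R \<rho> x)) \<le>
        K * (s powr (a - real m) * ?g (int m) x + s powr (a + real m) * ?g (- int m) x)" for x
    proof (cases "x > 0")
      case True
      have "norm (\<rho> x) \<le> C * (s powr a + x powr a) * \<bar>x - s\<bar> ^ n / fact n"
        unfolding \<rho>_def using f elim True C
        by (intro symbol_Taylor_remainder_le) (auto simp: symbol_of_degree_def)
      also have "\<dots> = C / fact n * \<bar>x - s\<bar> ^ n * (s powr a + x powr a)"
        by (simp add: mult_ac)
      also have "\<dots> \<le> C / fact n * \<bar>x - s\<bar> ^ n *
          (2 * (s powr (a - real m) * x powr real m + s powr (a + real m) * x powr (- real m)))"
        using \<open>C \<ge> 0\<close> elim True m by (intro mult_left_mono powr_sum_le_two_sided) auto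
      finally have "w x * norm (\<rho> x) \<le> w x * (C / fact n * \<bar>x - s\<bar> ^ n *
          (2 * (s powr (a - real m) * x powr real m + s powr (a + real m) * x powr (- real m))))"
        by (intro mult_left_mono) (auto simp: w_def)
      also have "\<dots> = K * (s powr (a - real m) * ?g (int m) x + s powr (a + real m) * ?g (- int m) x)"
        using True powr_add[of x s "real m"] powr_add[of x s "- real m"]
        by (simp add: w_def K_def algebra_simps)
      finally show ?thesis
        using True by (simp add: w_def)
    qed auto
    have "norm (Gamma (s + 1) *\<^sub>R (twisted_mellin f s - (\<Sum>r<n. tm_term f r s))) \<le>
        K * (s powr (a - real m) * J (int m) s + s powr (a + real m) * J (- int m) s)"
      unfolding has_bochner_integral_integral_eq[OF E, symmetric] has_bochner_integral_integral_eq[OF B, symmetric]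
      by (rule Bochner_Integration.integral_norm_bound_integral[OF integrable.intros[OF E] integrable.intros[OF B] le])
    also have "\<dots> = Gamma (s + 1) * (K * bnd s)"
      using G by (simp add: bnd_def field_simps)
    finally have "norm (twisted_mellin f s - (\<Sum>r<n. tm_term f r s)) \<le> K * bnd s"
      using G by simp
    also have "\<dots> \<le> K * norm (bnd s)"
      using \<open>C \<ge> 0\<close> by (intro mult_left_mono) (auto simp: K_def)
    finally show ?case by simp
  qed
  then have "(\<lambda>s. norm (twisted_mellin f s - (\<Sum>r<n. tm_term f r s))) \<in> O[at_top](bnd)"
    by (rule bigoI)
  also have "bnd \<in> O[at_top](\<lambda>s. s powr (k - real n / 2))"
    unfolding bnd_def
  proof (rule sum_in_bigo)
    \<comment> \<open>The shift \<open>c\<close> cancels against the prefactor: the total exponent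
      is \<open>b + c + n / 2 = a + n / 2\<close>, independent of \<open>m\<close>.\<close>
    have *: "(\<lambda>s. s powr b * (J c s / Gamma (s + 1))) \<in> O[at_top](\<lambda>s. s powr (k - real n / 2))"
      if "b + of_int c = a" for b c
    proof -
      have "(\<lambda>s. s powr b * (J c s / Gamma (s + 1))) \<in>
          O[at_top](\<lambda>s. s powr b * s powr (real n / 2 + of_int c))"
        unfolding J_def by (intro landau_o.big.mult landau_o.big_refl abs_moment_bigo)
      moreover have "b + (real n / 2 + of_int c) = k - real n / 2"
        using that by (simp add: a_def field_simps)
      ultimately show ?thesis
        by (simp flip: powr_add)
    qed
    show "(\<lambda>s. s powr (a - real m) * (J (int m) s / Gamma (s + 1))) \<in> O[at_top](\<lambda>s. s powr (k - real n / 2))"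
      by (rule *) simp
    show "(\<lambda>s. s powr (a + real m) * (J (- int m) s / Gamma (s + 1))) \<in> O[at_top](\<lambda>s. s powr (k - real n / 2))"
      by (rule *) simp
  qed
  finally show ?thesis .
qed

text \<open>Integrability is asserted along with the formulas, because the Bochner integral of a
  non-integrable function is a mere default value. The last two conjuncts together spell out the
  asymptotic expansion; taking norms lets one statement cover real and complex values.\<close>

theorem theorem3p2:
  fixes f :: "real \<Rightarrow> 'a::{real_normed_field, euclidean_space}" and k :: real
  assumes "symbol_of_degree k f"
  shows
    "(\<forall>r s. s > -1 \<longrightarrow>
        set_integrable lborel {0<..} (\<lambda>x. (x - s) ^ r * (x powr s * exp (- x))) \<and>
        tm_coeff r s =
          (\<Sum>i=0..r. (-1) ^ (r - i) * real (r choose i) * pochhammer (s + 1) i * s ^ (r - i))) \<and>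
     (\<forall>r. \<exists>p :: int poly. degree p = r div 2 \<and>
        (\<forall>s>-1. tm_coeff r s = poly (map_poly real_of_int p) s)) \<and>
     (\<forall>\<^sub>F s in at_top.
        set_integrable lborel {0<..} (\<lambda>x. f x * of_real (x powr s * exp (- x)))) \<and>
     (\<forall>r. (\<lambda>s. norm (tm_term f r s)) \<in>
        O[at_top](\<lambda>s. s powr (k - real r + real (r div 2)))) \<and>
     (\<forall>R. (\<lambda>s. norm (twisted_mellin f s - (\<Sum>r<R. tm_term f r s))) \<in>
        O[at_top](\<lambda>s. s powr (k - real R / 2)))"
proof (intro conjI allI impI)
  fix r :: nat and s :: real
  assume s: "s > -1"
  show "set_integrable lborel {0<..} (\<lambda>x. (x - s) ^ r * (x powr s * exp (- x)))"
    using has_bochner_integral_shifted_moment[OF s, of s r]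
    by (simp add: set_integrable_def has_bochner_integral_iff)
  show "tm_coeff r s =
      (\<Sum>i=0..r. (-1) ^ (r - i) * real (r choose i) * pochhammer (s + 1) i * s ^ (r - i))"
    by (rule tm_coeff_eq_sum[OF s])
next
  fix r :: nat
  show "\<exists>p :: int poly. degree p = r div 2 \<and>
      (\<forall>s>-1. tm_coeff r s = poly (map_poly real_of_int p) s)"
    by (intro exI[of _ "tm_coeff_poly r"])
       (simp add: degree_tm_coeff_poly poly_tm_coeff_poly tm_coeff_eq_shifted_moment)
next
  show "\<forall>\<^sub>F s in at_top. set_integrable lborel {0<..} (\<lambda>x. f x * of_real (x powr s * exp (- x)))"
    using eventually_gt_at_top[of "-1 - k"]
    by eventually_elim (rule symbol_set_integrable[OF assms], simp)
qed (fact tm_term_bigo[OF assms] twisted_mellin_remainder_bigo[OF assms])+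

end
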